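(* Consider the RBCD method with the discrepancy principle, with noisy data and parameter $\tau>1$, for solving $\sum_{i=1}^bv_{li}Kx_i=y_l$, $l=1,\dots,d$. Assume that $V=(v_{li})$ has full column rank and let $v^*:=\max\{\|v_i\|^2:i=1,\dots,b\}$, where $v_i$ is the $i$-th column of $V$. Assume $$0<\gamma<\min\{2/(v^*\|K\|^2),\ (2-2/\tau)/\|A\|^2\}$$ and let $x^\dagger$ denote the unique $x_0$-minimum-norm solution of the system. If the (deterministic) integer $k_\delta$ is chosen such that $k_\delta\to\infty$ as $\delta\to0$, then $\mathbb E[\|x_{k_\delta}^\delta-x^\dagger\|^2]\to0$ as $\delta\to0$.
   Context: Let $X,Y$ be real Hilbert spaces, $K:X\to Y$ a bounded linear operator, and $V=(v_{li})$ a real $d\times b$ matrix. Define $A:X^b\to Y^d$ by $Ax:=\big(\sum_{i=1}^bv_{li}Kx_i\big)_{l=1}^d$ and $A_i:X\to Y^d$ by $A_iz:=(v_{li}Kz)_{l=1}^d$, so that $Ax=\sum_{i=1}^bA_ix_i$ and $A_i^*\tilde y=\sum_{l=1}^dv_{li}K^*\tilde y_l$; $X^b$ and $Y^d$ carry the product inner products. The system reads $Ax=y$ with $y=(y_1,\dots,y_d)\in Y^d$, and it is assumed that $y\in\mathrm{Ran}(A)$. For each noise level $\delta>0$, $y^\delta\in Y^d$ is noisy data with $\|y^\delta-y\|\le\delta$. RBCD method with the discrepancy principle: let $i_0,i_1,\dots$ be independent random indices, each uniformly distributed on $\{1,\dots,b\}$. Start from $x_0^\delta:=x_0\in X^b$.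 For $k\ge0$ let $r_k^\delta:=Ax_k^\delta-y^\delta$, set $\gamma_k:=\gamma$ if $\|r_k^\delta\|>\tau\delta$ and $\gamma_k:=0$ if $\|r_k^\delta\|\le\tau\delta$, and define $x_{k+1,i}^\delta=x_{k,i}^\delta$ for $i\ne i_k$ and $x_{k+1,i_k}^\delta=x_{k,i_k}^\delta-\gamma_kA_{i_k}^*r_k^\delta$. (Thus an infinite sequence is defined, which stays constant once $\|r_k^\delta\|\le\tau\delta$.) The $x_0$-minimum-norm solution is the solution $x$ of $Ax=y$ minimizing $\|x-x_0\|$. $\mathbb E$ denotes expectation with respect to the random indices; $\|v_i\|$ is the Euclidean norm. *)

theory Defs
  imports "HOL-Probability.Probability"
begin

text \<open>
  Real Hilbert spaces are types of sort \<open>{real_inner, complete_space}\<close>. The matrix \<open>V = (v_li)\<close> is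
  \<open>V :: real ^ 'b ^ 'd\<close> with \<open>V $ l $ i = v_li\<close>. The library norm on \<open>'x ^ 'b\<close> and \<open>'y ^ 'd\<close> is the
  product Hilbert norm.
\<close>

definition sys_op ::
    "real ^ 'b ^ 'd \<Rightarrow> ('x::real_inner \<Rightarrow> 'y::real_inner) \<Rightarrow> 'x ^ 'b \<Rightarrow> 'y ^ 'd"
  where "sys_op V K x = (\<chi> l. \<Sum>i\<in>UNIV. (V $ l $ i) *\<^sub>R K (x $ i))"

definition block_op ::
    "real ^ 'b ^ 'd \<Rightarrow> ('x::real_inner \<Rightarrow> 'y::real_inner) \<Rightarrow> 'b \<Rightarrow> 'x \<Rightarrow> 'y ^ 'd"
  where "block_op V K i z = (\<chi> l. (V $ l $ i) *\<^sub>R K z)"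

definition max_col_sq :: "real ^ 'b ^ 'd \<Rightarrow> real"
  where "max_col_sq V = Max (range (\<lambda>i. (norm (column i V))\<^sup>2))"

definition is_min_norm_sol ::
    "('u::real_inner \<Rightarrow> 'v) \<Rightarrow> 'v \<Rightarrow> 'u \<Rightarrow> 'u \<Rightarrow> bool"
  where "is_min_norm_sol A y x0 x \<longleftrightarrow>
           A x = y \<and> (\<forall>z. A z = y \<longrightarrow> norm (x - x0) \<le> norm (z - x0))"

definition min_norm_sol :: "('u::real_inner \<Rightarrow> 'v) \<Rightarrow> 'v \<Rightarrow> 'u \<Rightarrow> 'u"
  where "min_norm_sol A y x0 = (THE x. is_min_norm_sol A y x0 x)"

text \<open>
  The iterate \<open>rbcd V K \<gamma> \<tau> \<delta> yd x0 idx k\<close> is \<open>x_k\<close> for the data \<open>yd\<close> at noise level \<open>\<delta>\<close>, along the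
  index sequence \<open>idx\<close>. Only \<open>idx 0, \<dots>, idx (k - 1)\<close> enter.
\<close>

primrec rbcd ::
    "real ^ 'b ^ 'd \<Rightarrow> ('x::real_inner \<Rightarrow> 'y::real_inner) \<Rightarrow> real \<Rightarrow> real \<Rightarrow> real \<Rightarrow>
     'y ^ 'd \<Rightarrow> 'x ^ 'b \<Rightarrow> (nat \<Rightarrow> 'b) \<Rightarrow> nat \<Rightarrow> 'x ^ 'b"
  where
    "rbcd V K \<gamma> \<tau> \<delta> yd x0 idx 0 = x0"
  | "rbcd V K \<gamma> \<tau> \<delta> yd x0 idx (Suc k) =
       (let x = rbcd V K \<gamma> \<tau> \<delta> yd x0 idx k;
            r = sys_op V K x - yd;
            \<gamma>k = (if norm r > \<tau> * \<delta> then \<gamma> else 0)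
        in \<chi> j. if j = idx k
                then x $ j - \<gamma>k *\<^sub>R adjoint (block_op V K (idx k)) r
                else x $ j)"

text \<open>
  The upper bound for the step size is an extended real, so that \<open>2 / 0\<close> and \<open>(2 - 2 / \<tau>) / 0\<close>
  (which occur exactly when \<open>K = 0\<close>, for \<open>V\<close> of full column rank and \<open>\<tau> > 1\<close>) are \<open>\<infinity>\<close> and not the
  junk value 0 of real division.
\<close>

definition step_bound ::
    "real ^ 'b ^ 'd \<Rightarrow> ('x::real_inner \<Rightarrow> 'y::real_inner) \<Rightarrow> real \<Rightarrow> ereal"
  where "step_bound V K \<tau> =
           min (2 / ereal (max_col_sq V * (onorm K)\<^sup>2))
               (ereal (2 - 2 / \<tau>) / ereal ((onorm (sys_op V K))\<^sup>2))"

end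

theory Submission
  imports Defs
begin

text \<open>
  With probability uniform on the index, one step reduces the mean squared distance to any solution
  by a multiple of the squared active residual, so \<open>E \<parallel>x_k - x\<^sup>\<dagger>\<parallel>\<^sup>2\<close> decreases in \<open>k\<close> for noisy
  data; for fixed \<open>k\<close> it converges, as \<open>\<delta> \<rightarrow> 0\<close>, to its value for exact data. It remains to show
  that the exact error \<open>e_k\<close> tends to 0 in mean square. The same descent estimate gives
  \<open>E \<parallel>A e_k\<parallel>\<^sup>2 \<rightarrow> 0\<close>. If \<open>e_0 = (K\<^sup>* w_i)_i\<close>, the error keeps this form, and for
  \<open>\<gamma> \<le> 2 / (v\<^sup>* \<parallel>K\<parallel>\<^sup>2)\<close> the norm of \<open>V w\<close> does not increase along any path; since \<open>V\<close> has a left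
  inverse, \<open>\<parallel>e_k\<parallel>\<^sup>2 = \<langle>w, K e_k\<rangle> \<le> const \<cdot> \<parallel>A e_k\<parallel>\<close>. Full column rank also makes
  \<open>ker A = (ker K)\<^sup>b\<close>, so the components of \<open>x_0 - x\<^sup>\<dagger>\<close> lie in the closure of the range of \<open>K\<^sup>*\<close>,
  and the general case follows by density.
\<close>

subsection \<open>Orthogonal projection and adjoints in Hilbert spaces\<close>

lemma sq_norm_add_le: "(norm (a + b))\<^sup>2 \<le> 2 * (norm a)\<^sup>2 + 2 * (norm b)\<^sup>2"
  for a b :: "'z::real_inner"
proof -
  have "0 \<le> (norm (a - b))\<^sup>2" by simp
  then show ?thesis
    by (simp add: power2_norm_eq_inner inner_simps inner_commute)
qed

lemma subspace_closure:
  fixes S :: "'a::real_normed_vector set"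
  assumes S: "subspace S"
  shows "subspace (closure S)"
proof (rule subspaceI)
  show "0 \<in> closure S" using S closure_subset subspace_0 by blast
next
  fix x y assume "x \<in> closure S" "y \<in> closure S"
  then obtain f g where "\<forall>n. f n \<in> S" "f \<longlonglongrightarrow> x" "\<forall>n. g n \<in> S" "g \<longlonglongrightarrow> y"
    unfolding closure_sequential by blast
  then show "x + y \<in> closure S"
    unfolding closure_sequential
    by (intro exI[of _ "\<lambda>n. f n + g n"]) (auto intro: tendsto_intros subspace_add[OF S])
next
  fix c :: real and x assume "x \<in> closure S"
  then obtain f where "\<forall>n. f n \<in> S" "f \<longlonglongrightarrow> x"
    unfolding closure_sequential by blast
  then show "c *\<^sub>R x \<in> closure S"
    unfolding closure_sequential
    by (intro exI[of _ "\<lambda>n. c *\<^sub>R f n"]) (auto intro: tendsto_intros subspace_scale[OF S])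
qed

text \<open>A minimizing sequence for the distance to \<open>x\<close> is Cauchy because midpoints
  stay in \<open>S\<close>; its limit is a nearest point, and there the first variation
  vanishes.\<close>

lemma closed_subspace_orthogonal_projection:
  fixes S :: "'a::{real_inner, complete_space} set"
  assumes S: "subspace S" and "closed S"
  obtains p where "p \<in> S" and "\<And>s. s \<in> S \<Longrightarrow> inner (x - p) s = 0"
proof -
  define d where "d = (INF s\<in>S. (norm (x - s))\<^sup>2)"
  have ne: "S \<noteq> {}" using S subspace_0 by blast
  have bdd: "bdd_below ((\<lambda>s. (norm (x - s))\<^sup>2) ` S)"
    by (rule bdd_belowI[of _ 0]) auto
  have d_le: "d \<le> (norm (x - s))\<^sup>2" if "s \<in> S" for s
    unfolding d_def by (rule cINF_lower[OF bdd that])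
  have "\<exists>s\<in>S. (norm (x - s))\<^sup>2 < d + 1 / real (Suc n)" for n
    using cINF_less_iff[OF ne bdd, of "d + 1 / real (Suc n)"] by (simp add: d_def)
  then obtain s where sS: "\<And>n. s n \<in> S"
    and s: "\<And>n. (norm (x - s n))\<^sup>2 < d + 1 / real (Suc n)"
    by metis
  \<comment> \<open>Parallelogram law for \<open>x - a\<close> and \<open>x - b\<close>.\<close>
  have par: "(norm (a - b))\<^sup>2 = 2 * (norm (x - a))\<^sup>2 + 2 * (norm (x - b))\<^sup>2
      - 4 * (norm (x - (1/2) *\<^sub>R (a + b)))\<^sup>2" for a b
    by (simp add: power2_norm_eq_inner inner_simps inner_commute algebra_simps)
  have near: "(norm (s m - s n))\<^sup>2 < 2 / real (Suc m) + 2 / real (Suc n)" for m n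
  proof -
    have "(1/2) *\<^sub>R (s m + s n) \<in> S"
      using S sS by (intro subspace_scale subspace_add) auto
    from d_le[OF this] show ?thesis
      using s[of m] s[of n] par[of "s m" "s n"] by simp
  qed
  have "Cauchy s"
  proof (rule metric_CauchyI)
    fix e :: real assume e: "e > 0"
    obtain N where N: "4 / e\<^sup>2 < real N" using reals_Archimedean2 by blast
    have "dist (s m) (s n) < e" if "m \<ge> N" "n \<ge> N" for m n
    proof -
      have "0 < 4 / e\<^sup>2" using e by simp
      then have N0: "0 < real N" using N by linarith
      have "2 / real (Suc j) \<le> 2 / real N" if "j \<ge> N" for j
        using N0 that by (intro divide_left_mono) auto
      from near[of m n] this[OF that(1)] this[OF that(2)]
      have "(norm (s m - s n))\<^sup>2 < 4 / real N" by linarith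
      also have "\<dots> < e\<^sup>2" using N N0 e by (simp add: field_simps)
      finally show ?thesis using e by (simp add: dist_norm power2_less_imp_less)
    qed
    then show "\<exists>M. \<forall>m\<ge>M. \<forall>n\<ge>M. dist (s m) (s n) < e" by blast
  qed
  then obtain p where p: "s \<longlonglongrightarrow> p" using Cauchy_convergent convergent_def by blast
  have pS: "p \<in> S" using \<open>closed S\<close> sS p closed_sequentially by blast
  have "(\<lambda>n. d + 1 / real (Suc n)) \<longlonglongrightarrow> d + 0"
    by (intro tendsto_intros LIMSEQ_Suc lim_1_over_n)
  moreover have "(\<lambda>n. (norm (x - s n))\<^sup>2) \<longlonglongrightarrow> (norm (x - p))\<^sup>2"
    by (intro tendsto_intros p)
  ultimately have p_le: "(norm (x - p))\<^sup>2 \<le> d"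
    using s by (intro LIMSEQ_le[where X = "\<lambda>n. (norm (x - s n))\<^sup>2"]) (auto intro: less_imp_le)
  have "inner (x - p) v = 0" if v: "v \<in> S" for v
  proof (cases "v = 0")
    case False
    \<comment> \<open>This \<open>t\<close> minimizes the quadratic
      \<open>(norm ((x - p) - t *\<^sub>R v))\<^sup>2\<close>; a nonzero inner product would make
      \<open>p + t *\<^sub>R v\<close> closer to \<open>x\<close> than \<open>p\<close>.\<close>
    define t where "t = inner (x - p) v / (norm v)\<^sup>2"
    have "p + t *\<^sub>R v \<in> S" using S pS v by (intro subspace_add subspace_scale)
    then have "(norm (x - p))\<^sup>2 \<le> (norm ((x - p) - t *\<^sub>R v))\<^sup>2"
      unfolding diff_diff_eq by (rule order_trans[OF p_le d_le])
    also have "\<dots> = (norm (x - p))\<^sup>2 - 2 * t * inner (x - p) v + t\<^sup>2 * (norm v)\<^sup>2"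
      unfolding power2_norm_eq_inner
      by (simp only: inner_diff_left inner_diff_right inner_scaleR_left inner_scaleR_right)
        (simp add: inner_commute power2_eq_square algebra_simps)
    also have "t\<^sup>2 * (norm v)\<^sup>2 = t * inner (x - p) v"
      using False by (simp add: t_def power2_eq_square)
    finally have "t * inner (x - p) v \<le> 0" by simp
    then have "(inner (x - p) v)\<^sup>2 \<le> 0"
      using False by (auto simp: t_def power2_eq_square divide_le_0_iff mult_le_0_iff)
    then show ?thesis by simp
  qed simp
  with pS show ?thesis using that by blast
qed

text \<open>The kernel has codimension at most one, so the part \<open>z\<close> of a point off the
  kernel that is orthogonal to the kernel spans its complement; evaluating \<open>f\<close> at
  \<open>z\<close> fixes the scale.\<close>

lemma riesz_representation:
  fixes f :: "'a::{real_inner, complete_space} \<Rightarrow> real"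
  assumes "bounded_linear f"
  obtains a where "\<And>x. f x = inner x a"
proof -
  interpret f: bounded_linear f by fact
  show ?thesis
  proof (cases "\<forall>x. f x = 0")
    case True
    then show ?thesis using that[of 0] by simp
  next
    case False
    then obtain x where x: "f x \<noteq> 0" by blast
    have "closed (f -` {0})"
      by (rule continuous_closed_vimage) (auto intro: f.isCont)
    moreover have "subspace (f -` {0})"
      by (rule subspaceI) (auto simp: f.add f.scaleR f.zero)
    ultimately obtain p where p: "f p = 0" and orth: "\<And>s. f s = 0 \<Longrightarrow> inner (x - p) s = 0"
      using closed_subspace_orthogonal_projection[of "f -` {0}" x] by auto
    define z where "z = x - p"
    have fz: "f z \<noteq> 0" using x p by (simp add: z_def f.diff)
    have z0: "inner z z \<noteq> 0" using fz by auto
    have "f v = inner v ((f z / inner z z) *\<^sub>R z)" for v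
    proof -
      have "f (v - (f v / f z) *\<^sub>R z) = 0" using fz by (simp add: f.diff f.scaleR)
      then have "inner z (v - (f v / f z) *\<^sub>R z) = 0" unfolding z_def by (rule orth)
      then have "inner z v = f v / f z * inner z z" by (simp add: inner_diff_right)
      then show ?thesis using fz z0 by (simp add: inner_commute field_simps)
    qed
    then show ?thesis using that by blast
  qed
qed

text \<open>\<open>adjoint\<close> is a choice term, so its defining identity needs a witness; Riesz
  representation of \<open>\<lambda>x. inner (K x) y\<close> supplies it for each
  \<open>y\<close>.\<close>

lemma inner_adjoint_right:
  fixes K :: "'x::{real_inner, complete_space} \<Rightarrow> 'y::real_inner"
  assumes "bounded_linear K"
  shows "inner x (adjoint K y) = inner (K x) y"
proof -
  have "\<exists>a. \<forall>x. inner (K x) y = inner x a" for y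
    by (rule riesz_representation[of "\<lambda>x. inner (K x) y"])
      (auto intro: bounded_linear_compose[OF bounded_linear_inner_left assms])
  then have "\<exists>f'. \<forall>x y. inner (K x) y = inner x (f' y)" by metis
  then show ?thesis unfolding adjoint_def by (rule someI2_ex) simp
qed

lemma bounded_linear_adjoint:
  fixes K :: "'x::{real_inner, complete_space} \<Rightarrow> 'y::real_inner"
  assumes K: "bounded_linear K"
  shows "bounded_linear (adjoint K)"
proof (rule bounded_linear_intro[where K = "onorm K"])
  note adj = inner_adjoint_right[OF K]
  show "adjoint K (a + b) = adjoint K a + adjoint K b" for a b
    by (rule vector_eq_rdot[THEN iffD1]) (metis adj inner_add_right inner_commute)
  show "adjoint K (c *\<^sub>R a) = c *\<^sub>R adjoint K a" for c a
    by (rule vector_eq_rdot[THEN iffD1]) (metis adj inner_scaleR_right inner_commute)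
  show "norm (adjoint K y) \<le> norm y * onorm K" for y
  proof -
    have "(norm (adjoint K y))\<^sup>2 = inner (K (adjoint K y)) y"
      by (simp add: power2_norm_eq_inner adj)
    also have "\<dots> \<le> norm (K (adjoint K y)) * norm y" by (rule norm_cauchy_schwarz)
    also have "\<dots> \<le> onorm K * norm (adjoint K y) * norm y"
      by (intro mult_right_mono onorm[OF K]) auto
    \<comment> \<open>One factor \<open>norm (adjoint K y)\<close> is cancelled next; if it
      vanishes, the bound is trivial.\<close>
    finally have "norm (adjoint K y) * norm (adjoint K y)
        \<le> (norm y * onorm K) * norm (adjoint K y)"
      by (simp add: power2_eq_square ac_simps)
    then show ?thesis
      by (cases "adjoint K y = 0") (auto simp: onorm_pos_le[OF K] mult_nonneg_nonneg)
  qed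
qed

subsection \<open>The system operator\<close>

lemma vec_eq_sum_axis: "x = (\<Sum>i\<in>UNIV. axis i (x $ i))"
  by (simp add: vec_eq_iff axis_def sum.delta' cong: if_cong)

lemma norm_axis [simp]: "norm (axis i x) = norm x"
  for x :: "'a::real_inner"
  by (simp add: norm_eq_sqrt_inner inner_axis)

lemma bounded_linear_axis: "bounded_linear (axis i :: 'a::real_inner \<Rightarrow> 'a ^ 'n)"
proof (rule bounded_linear_intro[where K = 1])
  show "axis i (x + y) = axis i x + axis i y" for x y :: 'a
    by (simp add: vec_eq_iff axis_def)
  show "axis i (c *\<^sub>R x) = c *\<^sub>R axis i x" for c and x :: 'a
    by (simp add: vec_eq_iff axis_def)
  show "norm (axis i x) \<le> norm x * 1" for x :: 'a by simp
qed

lemma bounded_linear_sys_op: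
  fixes K :: "'x::real_inner \<Rightarrow> 'y::real_inner"
  assumes "bounded_linear K"
  shows "bounded_linear (sys_op V K)"
proof -
  \<comment> \<open>Written as a sum of coordinate embeddings, so that boundedness follows from
    closure under sums and composition.\<close>
  have "sys_op V K = (\<lambda>x. \<Sum>l\<in>UNIV. axis l (\<Sum>i\<in>UNIV. (V $ l $ i) *\<^sub>R K (x $ i)))"
    by (rule ext, subst vec_eq_sum_axis) (simp add: sys_op_def)
  moreover have "bounded_linear (\<lambda>x. \<Sum>l\<in>UNIV. axis l (\<Sum>i\<in>UNIV. (V $ l $ i) *\<^sub>R K (x $ i)))"
    by (intro bounded_linear_sum bounded_linear_compose[OF bounded_linear_axis]
        bounded_linear_compose[OF bounded_linear_scaleR_right]
        bounded_linear_compose[OF assms] bounded_linear_vec_nth)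
  ultimately show ?thesis by simp
qed

lemma sys_op_mat_1: "sys_op (mat 1) K x = (\<chi> i. K (x $ i))"
  by (simp add: sys_op_def mat_def vec_eq_iff if_distrib[of "\<lambda>c. c *\<^sub>R _"] sum.delta cong: if_cong)

text \<open>Scalars pass through the linear \<open>J\<close>, so the matrices multiply while the
  operators compose. With \<open>J\<close> the identity and \<open>L ** V = mat 1\<close> this
  undoes the mixing by \<open>V\<close>.\<close>

lemma sys_op_sys_op:
  assumes "bounded_linear J"
  shows "sys_op L J (sys_op V K x) = sys_op (L ** V) (\<lambda>z. J (K z)) x"
proof -
  interpret J: bounded_linear J by fact
  have "(\<Sum>l\<in>UNIV. L $ m $ l *\<^sub>R J (\<Sum>i\<in>UNIV. V $ l $ i *\<^sub>R K (x $ i)))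
      = (\<Sum>i\<in>UNIV. (\<Sum>l\<in>UNIV. L $ m $ l * V $ l $ i) *\<^sub>R J (K (x $ i)))" for m
    by (simp add: J.sum J.scaleR scaleR_sum_right scaleR_sum_left) (rule sum.swap)
  then show ?thesis by (simp add: sys_op_def matrix_matrix_mult_def vec_eq_iff)
qed

lemma inner_sys_op:
  fixes K :: "'x::{real_inner, complete_space} \<Rightarrow> 'y::real_inner"
  assumes "bounded_linear K"
  shows "inner (sys_op V K x) r = inner x (sys_op (transpose V) (adjoint K) r)"
  unfolding sys_op_def inner_vec_def transpose_def
  by (simp add: inner_sum_left inner_sum_right inner_adjoint_right[OF assms]) (rule sum.swap)

text \<open>Follows from uniqueness of adjoints. \<open>sys_op (transpose V) (adjoint K)\<close>
  thereby plays the role of the adjoint of the whole system in the estimates.\<close>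

lemma adjoint_block_op:
  fixes K :: "'x::{real_inner, complete_space} \<Rightarrow> 'y::real_inner"
  assumes "bounded_linear K"
  shows "adjoint (block_op V K i) r = sys_op (transpose V) (adjoint K) r $ i"
proof -
  have "adjoint (block_op V K i) = (\<lambda>r. sys_op (transpose V) (adjoint K) r $ i)"
    by (rule adjoint_unique)
      (simp add: block_op_def sys_op_def inner_vec_def transpose_def inner_sum_right
        inner_adjoint_right[OF assms])
  then show ?thesis by simp
qed

text \<open>With the identity in place of \<open>K\<close>, \<open>block_op\<close> is the
  elementary tensor of column \<open>i\<close> with \<open>h\<close>.\<close>

lemma norm_block_op_id:
  fixes h :: "'y::real_inner"
  shows "(norm (block_op V (\<lambda>z. z) i h))\<^sup>2 = (norm (column i V))\<^sup>2 * (norm h)\<^sup>2"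
  by (simp add: block_op_def column_def norm_vec_def L2_set_def real_sqrt_pow2 sum_nonneg
      power_mult_distrib sum_distrib_right)

lemma sys_op_axis:
  assumes "bounded_linear K"
  shows "sys_op V K (axis i h) = block_op V K i h"
proof -
  interpret K: bounded_linear K by fact
  show ?thesis
    by (simp add: sys_op_def block_op_def vec_eq_iff axis_def K.zero if_distrib[of K]
        if_distrib[of "\<lambda>z. _ *\<^sub>R z"] sum.delta cong: if_cong)
qed

lemma inner_block_op_id:
  "inner u (block_op V (\<lambda>z. z) i h) = inner (sys_op (transpose V) (\<lambda>z. z) u $ i) h"
  by (simp add: block_op_def sys_op_def inner_vec_def transpose_def inner_sum_left)

subsection \<open>Averages over uniformly random index paths\<close>

text \<open>Expectation as a finite recursive average, conditioning on the first index. The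
  estimates use this form; measure theory enters only when it is identified with the true
  expectation.\<close>

primrec path_avg :: "('i::finite \<Rightarrow> 's \<Rightarrow> 's) \<Rightarrow> nat \<Rightarrow> ('s \<Rightarrow> real) \<Rightarrow> 's \<Rightarrow> real" where
  "path_avg T 0 f x = f x"
| "path_avg T (Suc n) f x = (\<Sum>i\<in>UNIV. path_avg T n f (T i x)) / CARD('i)"

text \<open>The newest index acts last, as in the iteration of the method, whereas
  \<open>path_avg\<close> peels off the first one.\<close>

primrec trajectory :: "('i \<Rightarrow> 's \<Rightarrow> 's) \<Rightarrow> (nat \<Rightarrow> 'i) \<Rightarrow> nat \<Rightarrow> 's \<Rightarrow> 's" where
  "trajectory T j 0 x = x"
| "trajectory T j (Suc n) x = T (j n) (trajectory T j n x)"

text \<open>Conditioning on the last index instead of the first, the form in which one-step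
  estimates apply.\<close>

lemma path_avg_Suc_right: "path_avg T (Suc n) f x = path_avg T n (\<lambda>x. (\<Sum>i\<in>UNIV. f (T i x)) / CARD('i)) x"
  for T :: "'i::finite \<Rightarrow> 's \<Rightarrow> 's"
  by (induction n arbitrary: x) simp_all

text \<open>Paths started in an invariant set never leave it, so the comparison is needed only
  there; this admits bounds valid only for errors of source form.\<close>

lemma path_avg_mono:
  assumes "\<And>i x. x \<in> S \<Longrightarrow> T i x \<in> S" and "\<And>x. x \<in> S \<Longrightarrow> f x \<le> g x" and "x \<in> S"
  shows "path_avg T n f x \<le> path_avg T n g x"
  using assms(3)
  by (induction n arbitrary: x) (auto intro!: divide_right_mono sum_mono simp: assms)

lemma path_avg_const: "path_avg T n (\<lambda>_. c) x = c"
  by (induction n arbitrary: x) simp_all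

lemma path_avg_nonneg: "(\<And>x. 0 \<le> f x) \<Longrightarrow> 0 \<le> path_avg T n f x"
  using path_avg_mono[of UNIV T "\<lambda>_. 0" f x n] by (simp add: path_avg_const)

lemma path_avg_add: "path_avg T n (\<lambda>x. f x + g x) x = path_avg T n f x + path_avg T n g x"
  by (induction n arbitrary: x) (simp_all add: sum.distrib add_divide_distrib)

lemma path_avg_mult_left: "path_avg T n (\<lambda>x. c * f x) x = c * path_avg T n f x"
  by (induction n arbitrary: x) (simp_all add: sum_distrib_left[symmetric])

text \<open>Transports averages over the iterates to averages over their errors, with
  \<open>h\<close> the shift by a solution.\<close>

lemma path_avg_semiconj:
  assumes "\<And>i x. h (S i x) = T i (h x)"
  shows "path_avg S n (\<lambda>x. f (h x)) x = path_avg T n f (h x)"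
  by (induction n arbitrary: x) (simp_all add: assms)

text \<open>Only finitely many index paths of length \<open>n\<close> occur. The hypothesis on
  \<open>T\<close> asks for convergence along converging arguments, which discontinuous maps
  \<open>T p\<close> can satisfy as well.\<close>

lemma tendsto_path_avg:
  fixes T :: "'p \<Rightarrow> 'i::finite \<Rightarrow> 's::topological_space \<Rightarrow> 's"
  assumes T: "\<And>i x x'. (x \<longlongrightarrow> x') F \<Longrightarrow> ((\<lambda>p. T p i (x p)) \<longlongrightarrow> T' i x') F"
    and f: "\<And>x x'. (x \<longlongrightarrow> x') F \<Longrightarrow> ((\<lambda>p. f (x p)) \<longlongrightarrow> f x') F"
    and "(x \<longlongrightarrow> x') F"
  shows "((\<lambda>p. path_avg (T p) n f (x p)) \<longlongrightarrow> path_avg T' n f x') F"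
  using assms(3)
proof (induction n arbitrary: x x')
  case 0
  then show ?case by (simp add: f)
next
  case (Suc n)
  show ?case
    by (simp, intro tendsto_intros Suc.IH T Suc.prems) simp
qed

section \<open>Identification of path averages with expectations\<close>

lemma trajectory_cong: "(\<And>m. m < n \<Longrightarrow> j m = j' m) \<Longrightarrow> trajectory T j n x = trajectory T j' n x"
  by (induction n) simp_all

text \<open>Fubini splits off the last coordinate, whose uniform integral is the inner average in
  \<open>path_avg_Suc_right\<close>.\<close>

lemma integral_PiM_uniform_trajectory:
  fixes T :: "'i::finite \<Rightarrow> 's \<Rightarrow> 's"
  shows "(\<integral>j. f (trajectory T j n x) \<partial>PiM {..<n} (\<lambda>_. uniform_count_measure UNIV)) = path_avg T n f x"
proof (induction n arbitrary: f)
  case 0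
  interpret P: prob_space "PiM {} (\<lambda>_::nat. uniform_count_measure (UNIV :: 'i set))"
    by (intro prob_space_PiM prob_space_uniform_count_measure) auto
  show ?case by (simp add: P.prob_space)
next
  case (Suc n)
  let ?U = "uniform_count_measure (UNIV :: 'i set)"
  have U: "prob_space ?U" by (rule prob_space_uniform_count_measure) auto
  interpret product_sigma_finite "\<lambda>_::nat. ?U"
    by (intro product_sigma_finite.intro prob_space_imp_sigma_finite U)
  interpret P: prob_space "PiM {..<Suc n} (\<lambda>_::nat. ?U)"
    by (intro prob_space_PiM U)
  \<comment> \<open>A finite product of finite discrete spaces is discrete, so every function on it
    is measurable; finiteness also provides the bound \<open>B\<close>.\<close>
  have sets: "sets (PiM {..<Suc n} (\<lambda>_::nat. ?U)) = Pow (PiE {..<Suc n} (\<lambda>_. UNIV))"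
  proof -
    have "sets (PiM {..<Suc n} (\<lambda>_::nat. ?U)) = sets (PiM {..<Suc n} (\<lambda>_::nat. count_space (UNIV :: 'i set)))"
      by (intro sets_PiM_cong) auto
    also have "\<dots> = sets (count_space (PiE {..<Suc n} (\<lambda>_. UNIV :: 'i set)))"
      by (subst count_space_PiM_finite) auto
    finally show ?thesis by simp
  qed
  define B where "B = Max ((\<lambda>j. norm (f (trajectory T j (Suc n) x))) ` PiE {..<Suc n} (\<lambda>_. UNIV))"
  have fin: "finite (PiE {..<Suc n} (\<lambda>_. UNIV :: 'i set))" by (rule finite_PiE) auto
  have int: "integrable (PiM {..<Suc n} (\<lambda>_::nat. ?U)) (\<lambda>j. f (trajectory T j (Suc n) x))"
  proof (rule P.integrable_const_bound[where B = B])
    show "AE j in PiM {..<Suc n} (\<lambda>_. ?U). norm (f (trajectory T j (Suc n) x)) \<le> B"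
      using fin by (intro AE_I2) (auto simp: B_def space_PiM space_uniform_count_measure)
    show "(\<lambda>j. f (trajectory T j (Suc n) x)) \<in> borel_measurable (PiM {..<Suc n} (\<lambda>_. ?U))"
      by (auto simp: measurable_def sets space_PiM space_uniform_count_measure)
  qed
  have ins: "{..<Suc n} = insert n {..<n}" by auto
  have "(\<integral>j. f (trajectory T j (Suc n) x) \<partial>PiM {..<Suc n} (\<lambda>_. ?U))
      = (\<integral>j. (\<integral>i. f (trajectory T (j(n := i)) (Suc n) x) \<partial>?U) \<partial>PiM {..<n} (\<lambda>_. ?U))"
    using int unfolding ins by (intro product_integral_insert) auto
  also have "\<dots> = (\<integral>j. (\<Sum>i\<in>UNIV. f (T i (trajectory T j n x))) / CARD('i) \<partial>PiM {..<n} (\<lambda>_. ?U))"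
  proof -
    have "trajectory T (j(n := i)) n x = trajectory T j n x" for j i by (rule trajectory_cong) auto
    then show ?thesis by (simp add: integral_uniform_count_measure)
  qed
  also have "\<dots> = path_avg T (Suc n) f x"
    unfolding path_avg_Suc_right
    by (rule Suc.IH[of "\<lambda>z. (\<Sum>i\<in>UNIV. f (T i z)) / CARD('i)"])
  finally show ?case .
qed

lemma expectation_trajectory:
  fixes T :: "'i::finite \<Rightarrow> 's \<Rightarrow> 's"
  assumes "prob_space M"
    and indep: "prob_space.indep_vars M (\<lambda>_. count_space UNIV) I UNIV"
    and unif: "\<And>n. distr M (count_space UNIV) (I n) = uniform_count_measure UNIV"
  shows "prob_space.expectation M (\<lambda>\<omega>. f (trajectory T (\<lambda>n. I n \<omega>) n x)) = path_avg T n f x"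
\<comment> \<open>The empty index set is treated apart: the characterization of independence by
  product laws, used below, is for nonempty families.\<close>
proof (cases n)
  case 0
  interpret prob_space M by fact
  show ?thesis using 0 by (simp add: prob_space)
next
  case (Suc m)
  interpret prob_space M by fact
  let ?C = "PiM {..<n} (\<lambda>_::nat. count_space (UNIV :: 'i set))"
  have rv: "random_variable (count_space UNIV) (I i)" for i
    using indep by (auto simp: indep_vars_def)
  have "indep_vars (\<lambda>_. count_space UNIV) I {..<n}"
    by (rule indep_vars_subset[OF indep]) auto
  then have D: "distr M ?C (\<lambda>\<omega>. \<lambda>i\<in>{..<n}. I i \<omega>)
      = PiM {..<n} (\<lambda>_. uniform_count_measure UNIV)"
    using Suc rv by (subst (asm) indep_vars_iff_distr_eq_PiM) (auto simp: unif)
  have C: "?C = count_space (PiE {..<n} (\<lambda>_. UNIV))"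
    by (rule count_space_PiM_finite) auto
  have meas: "(\<lambda>\<omega>. \<lambda>i\<in>{..<n}. I i \<omega>) \<in> measurable M ?C"
    by (intro measurable_restrict rv)
  \<comment> \<open>The trajectory reads only the indices below \<open>n\<close>, so the finite
    random vector of these replaces the whole sequence.\<close>
  have "expectation (\<lambda>\<omega>. f (trajectory T (\<lambda>n. I n \<omega>) n x))
      = expectation (\<lambda>\<omega>. f (trajectory T (\<lambda>i\<in>{..<n}. I i \<omega>) n x))"
    by (intro Bochner_Integration.integral_cong arg_cong[where f = f] trajectory_cong) auto
  also have "\<dots> = (\<integral>j. f (trajectory T j n x) \<partial>distr M ?C (\<lambda>\<omega>. \<lambda>i\<in>{..<n}. I i \<omega>))"
    by (rule integral_distr[symmetric, OF meas]) (simp add: C)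
  also have "\<dots> = path_avg T n f x" unfolding D by (rule integral_PiM_uniform_trajectory)
  finally show ?thesis .
qed

subsection \<open>Convergence of the block coordinate descent\<close>

text \<open>Full column rank enters as a left inverse \<open>L\<close>. The step size bounds are
  multiplied out, so that vanishing operator norms need no separate case.\<close>

locale rbcd_system =
  fixes K :: "'x::{real_inner, complete_space} \<Rightarrow> 'y::{real_inner, complete_space}"
    and V :: "real ^ 'b ^ 'd" and L :: "real ^ 'd ^ 'b" and \<gamma> \<tau> :: real
  assumes K: "bounded_linear K"
    and left_inverse: "L ** V = mat 1"
    and \<gamma>_pos: "0 < \<gamma>" and \<tau>_gt_1: "1 < \<tau>"
    and \<gamma>_col: "\<gamma> * (max_col_sq V * (onorm K)\<^sup>2) \<le> 2"
    and \<gamma>_op: "\<gamma> * (onorm (sys_op V K))\<^sup>2 < 2 - 2 / \<tau>"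
begin

abbreviation A :: "'x ^ 'b \<Rightarrow> 'y ^ 'd" where "A \<equiv> sys_op V K"

abbreviation At :: "'y ^ 'd \<Rightarrow> 'x ^ 'b" where "At \<equiv> sys_op (transpose V) (adjoint K)"

text \<open>Stopping is encoded in the residual: replacing it by 0 has the effect of a zero step
  size, and the step remains one expression with fixed \<open>\<gamma>\<close>.\<close>

definition active :: "real \<Rightarrow> 'y ^ 'd \<Rightarrow> 'y ^ 'd"
  where "active \<delta> r = (if norm r > \<tau> * \<delta> then r else 0)"

definition step :: "real \<Rightarrow> 'y ^ 'd \<Rightarrow> 'b \<Rightarrow> 'x ^ 'b \<Rightarrow> 'x ^ 'b"
  where "step \<delta> yd i x = x - \<gamma> *\<^sub>R axis i (At (active \<delta> (A x - yd)) $ i)"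

definition err_step :: "'b \<Rightarrow> 'x ^ 'b \<Rightarrow> 'x ^ 'b"
  where "err_step i e = e - \<gamma> *\<^sub>R axis i (At (A e) $ i)"

text \<open>The gain \<open>2 \<gamma> (1 - 1 / \<tau>)\<close> of the linear term minus the loss
  \<open>\<gamma>^2 ||A||^2\<close> of the quadratic term, averaged over the blocks.\<close>

definition gain :: real
  where "gain = \<gamma> * (2 - 2 / \<tau> - \<gamma> * (onorm A)\<^sup>2) / CARD('b)"

sublocale Kt: bounded_linear "adjoint K" by (rule bounded_linear_adjoint[OF K])
sublocale A: bounded_linear A by (rule bounded_linear_sys_op[OF K])
sublocale At: bounded_linear At by (rule bounded_linear_sys_op[OF Kt.bounded_linear_axioms])

text \<open>At noise level 0 the test stops only at residual 0, where both branches agree.\<close>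

lemma active_0: "active 0 r = r"
  by (simp add: active_def)

lemma gain_pos: "0 < gain"
  using \<gamma>_pos \<gamma>_op by (simp add: gain_def)

lemma rbcd_eq_trajectory: "rbcd V K \<gamma> \<tau> \<delta> yd x0 j n = trajectory (step \<delta> yd) j n x0"
proof (induction n)
  case (Suc n)
  have "rbcd V K \<gamma> \<tau> \<delta> yd x0 j (Suc n) = step \<delta> yd (j n) (rbcd V K \<gamma> \<tau> \<delta> yd x0 j n)"
    by (auto simp: step_def active_def axis_def Let_def vec_eq_iff adjoint_block_op[OF K] At.zero)
  then show ?case by (simp only: Suc.IH trajectory.simps)
qed simp

section \<open>Mean-square descent towards solutions\<close>

lemma norm_At_le: "norm (At r) \<le> onorm A * norm r"
proof -
  have "(norm (At r))\<^sup>2 = inner (A (At r)) r"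
    by (simp add: power2_norm_eq_inner inner_sys_op[OF K])
  also have "\<dots> \<le> norm (A (At r)) * norm r" by (rule norm_cauchy_schwarz)
  also have "\<dots> \<le> onorm A * norm (At r) * norm r"
    by (intro mult_right_mono onorm A.bounded_linear_axioms) auto
  finally have "norm (At r) * norm (At r) \<le> (onorm A * norm r) * norm (At r)"
    by (simp add: power2_eq_square ac_simps)
  then show ?thesis
    by (cases "At r = 0") (auto simp: onorm_pos_le[OF A.bounded_linear_axioms])
qed

text \<open>Averaging over the block index reassembles the full inner product and norm, so the mean
  change of the squared distance is that of a full gradient step divided by
  \<open>CARD('b)\<close>.\<close>

lemma mean_sq_dist_step_le:
  assumes "0 \<le> \<delta>" and "norm (yd - A z) \<le> \<delta>"
  shows "(\<Sum>i\<in>UNIV. (norm (step \<delta> yd i x - z))\<^sup>2) / CARD('b)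
    \<le> (norm (x - z))\<^sup>2 - gain * (norm (active \<delta> (A x - yd)))\<^sup>2"
proof -
  define q where "q = active \<delta> (A x - yd)"
  define a where "a = At q"
  \<comment> \<open>While the test is active, the data error is at most
    \<open>norm q / \<tau>\<close>, so noise costs at most the fraction \<open>1 / \<tau>\<close> of
    \<open>(norm q)\<^sup>2\<close>; after stopping, \<open>q = 0\<close>.\<close>
  have inner_ge: "(1 - 1 / \<tau>) * (norm q)\<^sup>2 \<le> inner (x - z) a"
  proof (cases "norm (A x - yd) > \<tau> * \<delta>")
    case True
    have q: "q = A x - yd" using True by (simp add: q_def active_def)
    have "\<delta> \<le> norm q / \<tau>" using True \<tau>_gt_1 by (simp add: q field_simps)
    then have "norm (yd - A z) \<le> norm q / \<tau>" using assms by simp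
    then have "norm (yd - A z) * norm q \<le> norm q / \<tau> * norm q" by (rule mult_right_mono) simp
    moreover have "\<bar>inner (yd - A z) q\<bar> \<le> norm (yd - A z) * norm q"
      by (rule Cauchy_Schwarz_ineq2)
    moreover have "inner (x - z) a = (norm q)\<^sup>2 + inner (yd - A z) q"
      unfolding a_def inner_sys_op[OF K, symmetric]
      by (simp add: A.diff q power2_norm_eq_inner algebra_simps inner_diff_left)
    ultimately show ?thesis by (simp add: algebra_simps power2_eq_square)
  next
    case False
    then show ?thesis by (simp add: q_def a_def active_def At.zero)
  qed
  have "(norm a)\<^sup>2 \<le> (onorm A)\<^sup>2 * (norm q)\<^sup>2"
    unfolding power_mult_distrib[symmetric] a_def by (intro power_mono norm_At_le) simp
  then have *: "\<gamma>\<^sup>2 * (norm a)\<^sup>2 \<le> \<gamma>\<^sup>2 * ((onorm A)\<^sup>2 * (norm q)\<^sup>2)"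
    by (rule mult_left_mono) simp
  have **: "2 * \<gamma> * ((1 - 1 / \<tau>) * (norm q)\<^sup>2) \<le> 2 * \<gamma> * inner (x - z) a"
    using inner_ge \<gamma>_pos by (intro mult_left_mono) auto
  have le: "\<gamma>\<^sup>2 * (norm a)\<^sup>2 - 2 * \<gamma> * inner (x - z) a
      \<le> - (real CARD('b) * (gain * (norm q)\<^sup>2))"
  proof -
    have "real CARD('b) * (gain * (norm q)\<^sup>2)
        = \<gamma> * (2 - 2 / \<tau> - \<gamma> * (onorm A)\<^sup>2) * (norm q)\<^sup>2"
      by (simp add: gain_def)
    also have "\<dots> = 2 * \<gamma> * ((1 - 1 / \<tau>) * (norm q)\<^sup>2) - \<gamma>\<^sup>2 * ((onorm A)\<^sup>2 * (norm q)\<^sup>2)"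
      by (simp add: algebra_simps power2_eq_square)
    finally show ?thesis using * ** by linarith
  qed
  have "(\<Sum>i\<in>UNIV. (norm (step \<delta> yd i x - z))\<^sup>2)
      = (\<Sum>i\<in>UNIV. (norm (x - z))\<^sup>2 - 2 * \<gamma> * inner ((x - z) $ i) (a $ i)
          + \<gamma>\<^sup>2 * inner (a $ i) (a $ i))"
  proof (rule sum.cong[OF refl])
    fix i
    have "step \<delta> yd i x - z = (x - z) - \<gamma> *\<^sub>R axis i (a $ i)"
      by (simp add: step_def a_def q_def)
    then show "(norm (step \<delta> yd i x - z))\<^sup>2 = (norm (x - z))\<^sup>2
        - 2 * \<gamma> * inner ((x - z) $ i) (a $ i) + \<gamma>\<^sup>2 * inner (a $ i) (a $ i)"
      unfolding power2_norm_eq_inner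
      by (simp only: inner_diff_left[of "x - z"] inner_diff_right[of _ "x - z"] inner_scaleR_left
          inner_scaleR_right inner_axis inner_axis' axis_nth inner_commute[of "a $ i" "(x - z) $ i"])
        (simp add: power2_eq_square inner_diff_left algebra_simps)
  qed
  also have "\<dots> = CARD('b) * (norm (x - z))\<^sup>2 + (\<gamma>\<^sup>2 * (norm a)\<^sup>2 - 2 * \<gamma> * inner (x - z) a)"
    by (simp add: sum.distrib sum_subtractf sum_distrib_left[symmetric] power2_norm_eq_inner
        inner_vec_def[of a] inner_vec_def[of "x - z"])
  also have "\<dots> \<le> CARD('b) * ((norm (x - z))\<^sup>2 - gain * (norm q)\<^sup>2)"
    using le by (simp add: algebra_simps)
  finally show ?thesis by (simp add: q_def field_simps)
qed

lemma path_avg_sq_dist_Suc_le: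
  assumes "0 \<le> \<delta>" and "norm (yd - A z) \<le> \<delta>"
  shows "path_avg (step \<delta> yd) (Suc n) (\<lambda>x. (norm (x - z))\<^sup>2) x
    \<le> path_avg (step \<delta> yd) n (\<lambda>x. (norm (x - z))\<^sup>2) x"
  unfolding path_avg_Suc_right
proof (rule path_avg_mono[of UNIV])
  fix x
  have "0 \<le> gain * (norm (active \<delta> (A x - yd)))\<^sup>2" using gain_pos by simp
  with mean_sq_dist_step_le[OF assms, of x]
  show "(\<Sum>i\<in>UNIV. (norm (step \<delta> yd i x - z))\<^sup>2) / CARD('b) \<le> (norm (x - z))\<^sup>2"
    by linarith
qed auto

text \<open>Serves to compare the late index \<open>k \<delta>\<close> with a fixed earlier
  one.\<close>

lemma path_avg_sq_dist_antimono:
  assumes "0 \<le> \<delta>" and "norm (yd - A z) \<le> \<delta>" and "m \<le> n"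
  shows "path_avg (step \<delta> yd) n (\<lambda>x. (norm (x - z))\<^sup>2) x
    \<le> path_avg (step \<delta> yd) m (\<lambda>x. (norm (x - z))\<^sup>2) x"
  using \<open>m \<le> n\<close>
  by (rule lift_Suc_antimono_le[where f = "\<lambda>n. path_avg (step \<delta> yd) n (\<lambda>x. (norm (x - z))\<^sup>2) x", rotated])
    (rule path_avg_sq_dist_Suc_le[OF assms(1,2)])

text \<open>The discrepancy test is discontinuous in the residual, but since it alters the residual by
  at most \<open>\<tau>\<delta>\<close>, it disappears in the limit.\<close>

lemma tendsto_step:
  assumes yd: "(yd \<longlongrightarrow> y) (at_right 0)" and x: "(x \<longlongrightarrow> x') (at_right 0)"
  shows "((\<lambda>\<delta>. step \<delta> (yd \<delta>) i (x \<delta>)) \<longlongrightarrow> step 0 y i x') (at_right 0)"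
proof -
  let ?r = "\<lambda>\<delta>. A (x \<delta>) - yd \<delta>"
  have r: "(?r \<longlongrightarrow> A x' - y) (at_right 0)"
    by (intro tendsto_intros A.tendsto x yd)
  have "((\<lambda>\<delta>. active \<delta> (?r \<delta>) - ?r \<delta>) \<longlongrightarrow> 0) (at_right 0)"
  proof (rule Lim_null_comparison)
    show "\<forall>\<^sub>F \<delta> in at_right 0. norm (active \<delta> (?r \<delta>) - ?r \<delta>) \<le> \<tau> * \<delta>"
      using eventually_at_right_less[of 0]
      by eventually_elim (use \<tau>_gt_1 in \<open>auto simp: active_def norm_minus_commute not_less\<close>)
    have "((\<lambda>\<delta>. \<tau> * \<delta>) \<longlongrightarrow> \<tau> * 0) (at_right 0)" by (intro tendsto_intros)
    then show "((\<lambda>\<delta>. \<tau> * \<delta>) \<longlongrightarrow> 0) (at_right 0)" by simp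
  qed
  from tendsto_add[OF this r]
  have "((\<lambda>\<delta>. active \<delta> (?r \<delta>)) \<longlongrightarrow> active 0 (A x' - y)) (at_right 0)"
    by (simp add: active_0)
  then show ?thesis
    unfolding step_def
    by (intro tendsto_intros x bounded_linear.tendsto[OF bounded_linear_axis] At.tendsto)
qed

section \<open>The error recursion for exact data\<close>

lemma step_0_diff: "step 0 (A z) i x - z = err_step i (x - z)"
  by (simp add: step_def err_step_def active_0 A.diff)

text \<open>The descent estimate for data \<open>A 0\<close> and solution 0, where the iterate is
  its own error.\<close>

lemma mean_sq_err_step_le:
  "(\<Sum>i\<in>UNIV. (norm (err_step i e))\<^sup>2) / CARD('b) \<le> (norm e)\<^sup>2 - gain * (norm (A e))\<^sup>2"
  using mean_sq_dist_step_le[of 0 "A 0" 0 e] step_0_diff[of 0 _ e]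
  by (simp add: A.zero active_0)

lemma err_step_add: "err_step i (e + e') = err_step i e + err_step i e'"
  by (simp add: err_step_def A.add At.add vec_eq_iff axis_def algebra_simps)

lemma path_avg_err_step_Suc_le:
  "path_avg err_step (Suc n) (\<lambda>e. (norm e)\<^sup>2) e
    \<le> path_avg err_step n (\<lambda>e. (norm e)\<^sup>2) e - gain * path_avg err_step n (\<lambda>e. (norm (A e))\<^sup>2) e"
proof -
  have "path_avg err_step (Suc n) (\<lambda>e. (norm e)\<^sup>2) e
      \<le> path_avg err_step n (\<lambda>e. (norm e)\<^sup>2 + (- gain) * (norm (A e))\<^sup>2) e"
    unfolding path_avg_Suc_right by (rule path_avg_mono[of UNIV]) (use mean_sq_err_step_le in auto)
  then show ?thesis unfolding path_avg_add path_avg_mult_left by simp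
qed

lemma path_avg_err_step_decseq: "decseq (\<lambda>n. path_avg err_step n (\<lambda>e. (norm e)\<^sup>2) e)"
proof (rule decseq_SucI)
  fix n
  have "0 \<le> gain * path_avg err_step n (\<lambda>e. (norm (A e))\<^sup>2) e"
    using gain_pos by (intro mult_nonneg_nonneg path_avg_nonneg) auto
  with path_avg_err_step_Suc_le[of n e]
  show "path_avg err_step (Suc n) (\<lambda>e. (norm e)\<^sup>2) e \<le> path_avg err_step n (\<lambda>e. (norm e)\<^sup>2) e"
    by linarith
qed

text \<open>The mean square errors decrease and are nonnegative, so their consecutive differences
  tend to 0; these dominate \<open>gain\<close> times the mean square residual.\<close>

lemma path_avg_residual_tendsto_0: "(\<lambda>n. path_avg err_step n (\<lambda>e. (norm (A e))\<^sup>2) e) \<longlonglongrightarrow> 0"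
proof -
  let ?a = "\<lambda>n. path_avg err_step n (\<lambda>e. (norm e)\<^sup>2) e"
  have "0 \<le> ?a n" for n by (rule path_avg_nonneg) simp
  then obtain l where l: "?a \<longlonglongrightarrow> l"
    using decseq_convergent[OF path_avg_err_step_decseq] by blast
  have "(\<lambda>n. (?a n - ?a (Suc n)) / gain) \<longlonglongrightarrow> (l - l) / gain"
    using gain_pos by (intro tendsto_intros l LIMSEQ_Suc) auto
  then have "(\<lambda>n. (?a n - ?a (Suc n)) / gain) \<longlonglongrightarrow> 0" by simp
  then show ?thesis
  proof (rule real_tendsto_sandwich[OF _ _ tendsto_const, rotated 2])
    show "\<forall>\<^sub>F n in sequentially. 0 \<le> path_avg err_step n (\<lambda>e. (norm (A e))\<^sup>2) e"
      by (intro always_eventually allI path_avg_nonneg) simp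
    show "\<forall>\<^sub>F n in sequentially. path_avg err_step n (\<lambda>e. (norm (A e))\<^sup>2) e \<le> (?a n - ?a (Suc n)) / gain"
      using path_avg_err_step_Suc_le gain_pos
      by (intro always_eventually allI) (simp add: field_simps)
  qed
qed

section \<open>Errors of source form, with \<open>w\<close> measured by the norm of
  \<open>V w\<close>\<close>

definition source_ball :: "real \<Rightarrow> ('x ^ 'b) set"
  where "source_ball C = {e. \<exists>w. e = (\<chi> i. adjoint K (w $ i)) \<and> norm (sys_op V (\<lambda>z. z) w) \<le> C}"

text \<open>On \<open>u = V w\<close> the step subtracts \<open>\<gamma>\<close> times the tensor of
  column \<open>i\<close> with \<open>h = K K^* g\<close>, where \<open>g\<close> is component
  \<open>i\<close> of \<open>V^T u\<close>. The squared norm changes by at most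
  \<open>(\<gamma> v^* ||K||^2 - 2) \<gamma> ||K^* g||^2\<close>, which is not positive.\<close>

lemma err_step_source_ball:
  assumes "e \<in> source_ball C"
  shows "err_step i e \<in> source_ball C"
proof -
  obtain w where e: "e = (\<chi> i. adjoint K (w $ i))" and w: "norm (sys_op V (\<lambda>z. z) w) \<le> C"
    using assms by (auto simp: source_ball_def)
  interpret K: bounded_linear K by (rule K)
  interpret S: bounded_linear "sys_op V (\<lambda>z::'y. z)"
    by (rule bounded_linear_sys_op[OF bounded_linear_ident])
  define u where "u = sys_op V (\<lambda>z. z) w"
  define g where "g = sys_op (transpose V) (\<lambda>z. z) u $ i"
  define h where "h = K (adjoint K g)"
  have Ae: "A e $ l = K (adjoint K (u $ l))" for l
    by (simp add: e u_def sys_op_def Kt.sum Kt.scaleR K.sum K.scaleR)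
  have At_Ae: "At (A e) $ i = adjoint K h"
    by (simp add: g_def h_def sys_op_def[of "transpose V"] Ae Kt.sum Kt.scaleR K.sum K.scaleR)
  have err: "err_step i e = (\<chi> j. adjoint K ((w - \<gamma> *\<^sub>R axis i h) $ j))"
  proof -
    have "e $ j = adjoint K (w $ j)" for j by (simp add: e)
    then show ?thesis
      by (simp add: err_step_def At_Ae vec_eq_iff axis_def Kt.diff Kt.scaleR Kt.zero)
  qed
  have new: "sys_op V (\<lambda>z. z) (w - \<gamma> *\<^sub>R axis i h) = u - \<gamma> *\<^sub>R block_op V (\<lambda>z. z) i h"
    by (simp add: S.diff S.scaleR u_def sys_op_axis[OF bounded_linear_ident])
  have col: "(norm (column i V))\<^sup>2 \<le> max_col_sq V"
    unfolding max_col_sq_def by (rule Max_ge) auto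
  have "norm h \<le> onorm K * norm (adjoint K g)" unfolding h_def by (rule onorm[OF K])
  then have "(norm h)\<^sup>2 \<le> (onorm K)\<^sup>2 * (norm (adjoint K g))\<^sup>2"
    by (metis norm_ge_zero power_mono power_mult_distrib)
  then have "(norm (column i V))\<^sup>2 * (norm h)\<^sup>2
      \<le> max_col_sq V * ((onorm K)\<^sup>2 * (norm (adjoint K g))\<^sup>2)"
    using col order_trans[OF zero_le_power2 col] by (intro mult_mono) auto
  then have "\<gamma>\<^sup>2 * ((norm (column i V))\<^sup>2 * (norm h)\<^sup>2)
      \<le> \<gamma>\<^sup>2 * (max_col_sq V * ((onorm K)\<^sup>2 * (norm (adjoint K g))\<^sup>2))"
    by (rule mult_left_mono) simp
  also have "\<dots> = \<gamma> * (norm (adjoint K g))\<^sup>2 * (\<gamma> * (max_col_sq V * (onorm K)\<^sup>2))"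
    by (simp add: power2_eq_square)
  also have "\<dots> \<le> \<gamma> * (norm (adjoint K g))\<^sup>2 * 2"
    using \<gamma>_pos \<gamma>_col by (intro mult_left_mono) auto
  finally have *: "\<gamma>\<^sup>2 * ((norm (column i V))\<^sup>2 * (norm h)\<^sup>2) \<le> \<gamma> * (norm (adjoint K g))\<^sup>2 * 2" .
  \<comment> \<open>Moving the column and then \<open>K\<close> to the other side turns the cross
    term into a square.\<close>
  have "inner u (block_op V (\<lambda>z. z) i h) = (norm (adjoint K g))\<^sup>2"
    by (simp add: inner_block_op_id g_def[symmetric] h_def power2_norm_eq_inner
        inner_adjoint_right[OF K] inner_commute)
  then have "(norm (u - \<gamma> *\<^sub>R block_op V (\<lambda>z. z) i h))\<^sup>2 = (norm u)\<^sup>2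
      - \<gamma> * (norm (adjoint K g))\<^sup>2 * 2 + \<gamma>\<^sup>2 * ((norm (column i V))\<^sup>2 * (norm h)\<^sup>2)"
    unfolding norm_block_op_id[symmetric] power2_norm_eq_inner[of "u - _"]
      power2_norm_eq_inner[of u] power2_norm_eq_inner[of "block_op _ _ _ _"]
    by (simp add: inner_diff_left inner_diff_right inner_commute power2_eq_square)
  then have "(norm (u - \<gamma> *\<^sub>R block_op V (\<lambda>z. z) i h))\<^sup>2 \<le> (norm u)\<^sup>2"
    using * by linarith
  then have "norm (u - \<gamma> *\<^sub>R block_op V (\<lambda>z. z) i h) \<le> C"
    using w power2_le_imp_le[of _ "norm u"] unfolding u_def by fastforce
  then show ?thesis unfolding source_ball_def new[symmetric] err by blast
qed

text \<open>The left inverse unmixes the blocks. Hence every \<open>K (e $ i)\<close> is controlled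
  by \<open>A e\<close>, and vanishes if \<open>A e\<close> does.\<close>

lemma L_A: "sys_op L (\<lambda>z. z) (A e) = (\<chi> i. K (e $ i))"
  by (simp add: sys_op_sys_op left_inverse sys_op_mat_1)

text \<open>Moving \<open>adjoint K\<close> across writes the squared norm as the pairing of
  \<open>(\<chi> i. K (e $ i))\<close> with \<open>w\<close>; \<open>L\<close> recovers the former
  from \<open>A e\<close> and the latter from \<open>V w\<close>.\<close>

lemma sq_norm_le_residual_on_source_ball:
  obtains B where "\<And>e C. e \<in> source_ball C \<Longrightarrow> (norm e)\<^sup>2 \<le> B * C * norm (A e)"
proof -
  interpret S: bounded_linear "sys_op L (\<lambda>z::'y. z)"
    by (rule bounded_linear_sys_op[OF bounded_linear_ident])
  define b where "b = onorm (sys_op L (\<lambda>z::'y. z))"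
  have b: "norm (sys_op L (\<lambda>z::'y. z) u) \<le> b * norm u" for u
    unfolding b_def by (rule onorm[OF S.bounded_linear_axioms])
  have b0: "0 \<le> b" unfolding b_def by (rule onorm_pos_le[OF S.bounded_linear_axioms])
  show ?thesis
  proof
    fix e C assume "e \<in> source_ball C"
    then obtain w where e: "e = (\<chi> i. adjoint K (w $ i))" and w: "norm (sys_op V (\<lambda>z. z) w) \<le> C"
      by (auto simp: source_ball_def)
    have Lw: "sys_op L (\<lambda>z. z) (sys_op V (\<lambda>z. z) w) = w"
      by (simp add: sys_op_sys_op left_inverse sys_op_mat_1)
    have "(norm e)\<^sup>2 = inner (\<chi> i. K (e $ i)) w"
      unfolding power2_norm_eq_inner inner_vec_def
      by (subst (2) e) (simp add: inner_adjoint_right[OF K])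
    also have "\<dots> \<le> norm (sys_op L (\<lambda>z. z) (A e)) * norm (sys_op L (\<lambda>z. z) (sys_op V (\<lambda>z. z) w))"
      unfolding L_A Lw by (rule norm_cauchy_schwarz)
    also have "\<dots> \<le> (b * norm (A e)) * (b * C)"
      using b b0 w by (intro mult_mono order_trans[OF b] mult_left_mono) auto
    finally show "(norm e)\<^sup>2 \<le> b\<^sup>2 * C * norm (A e)" by (simp add: power2_eq_square ac_simps)
  qed
qed

lemma path_avg_err_step_tendsto_0_source:
  assumes "e \<in> source_ball C"
  shows "(\<lambda>n. path_avg err_step n (\<lambda>e. (norm e)\<^sup>2) e) \<longlonglongrightarrow> 0"
proof -
  obtain B where B: "\<And>e C. e \<in> source_ball C \<Longrightarrow> (norm e)\<^sup>2 \<le> B * C * norm (A e)"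
    using sq_norm_le_residual_on_source_ball by metis
  have "\<exists>N. \<forall>n\<ge>N. norm (path_avg err_step n (\<lambda>e. (norm e)\<^sup>2) e - 0) < \<epsilon>" if \<epsilon>: "\<epsilon> > 0" for \<epsilon>
  proof -
    \<comment> \<open>Young's inequality bounds \<open>B * C * norm (A e)\<close> by
      \<open>\<epsilon> / 2\<close> plus \<open>D\<close> times the squared residual, whose mean
      tends to 0.\<close>
    define D where "D = (B * C)\<^sup>2 / \<epsilon>"
    have le: "path_avg err_step n (\<lambda>e. (norm e)\<^sup>2) e \<le> \<epsilon> / 2 + D * path_avg err_step n (\<lambda>e. (norm (A e))\<^sup>2) e" for n
    proof -
      have "path_avg err_step n (\<lambda>e. (norm e)\<^sup>2) e \<le> path_avg err_step n (\<lambda>e. \<epsilon> / 2 + D * (norm (A e))\<^sup>2) e"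
      proof (rule path_avg_mono[of "source_ball C"])
        fix e assume "e \<in> source_ball C"
        from B[OF this] have "(norm e)\<^sup>2 \<le> B * C * norm (A e)" .
        also have "\<dots> \<le> \<epsilon> / 2 + D * (norm (A e))\<^sup>2"
        proof -
          have "0 \<le> (\<epsilon> - B * C * norm (A e))\<^sup>2" by simp
          then have "2 * \<epsilon> * (B * C * norm (A e)) \<le> \<epsilon>\<^sup>2 + (B * C)\<^sup>2 * (norm (A e))\<^sup>2"
            by (simp add: power2_diff power_mult_distrib)
          moreover have "0 \<le> (B * C)\<^sup>2 * (norm (A e))\<^sup>2" by simp
          ultimately have "2 * \<epsilon> * (B * C * norm (A e)) \<le> \<epsilon>\<^sup>2 + 2 * ((B * C)\<^sup>2 * (norm (A e))\<^sup>2)"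
            by linarith
          then show ?thesis using \<epsilon> by (simp add: D_def field_simps power2_eq_square)
        qed
        finally show "(norm e)\<^sup>2 \<le> \<epsilon> / 2 + D * (norm (A e))\<^sup>2" .
      qed (use err_step_source_ball assms in auto)
      then show ?thesis unfolding path_avg_add path_avg_mult_left path_avg_const .
    qed
    have "(\<lambda>n. \<epsilon> / 2 + D * path_avg err_step n (\<lambda>e. (norm (A e))\<^sup>2) e) \<longlonglongrightarrow> \<epsilon> / 2 + D * 0"
      by (intro tendsto_intros path_avg_residual_tendsto_0)
    then have "\<forall>\<^sub>F n in sequentially. \<epsilon> / 2 + D * path_avg err_step n (\<lambda>e. (norm (A e))\<^sup>2) e < \<epsilon>"
      by (rule order_tendstoD) (use \<epsilon> in simp)
    then obtain N where "\<forall>n\<ge>N. \<epsilon> / 2 + D * path_avg err_step n (\<lambda>e. (norm (A e))\<^sup>2) e < \<epsilon>"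
      by (auto simp: eventually_sequentially)
    moreover have "0 \<le> path_avg err_step n (\<lambda>e. (norm e)\<^sup>2) e" for n by (rule path_avg_nonneg) simp
    ultimately show ?thesis using le by (auto intro!: exI[of _ N] intro: le_less_trans)
  qed
  then show ?thesis by (rule LIMSEQ_I)
qed

text \<open>Since \<open>err_step\<close> is additive, a splitting of the initial error persists
  along every index path.\<close>

lemma path_avg_err_step_add_le:
  "path_avg err_step n (\<lambda>e. (norm e)\<^sup>2) (e + e')
    \<le> 2 * path_avg err_step n (\<lambda>e. (norm e)\<^sup>2) e + 2 * path_avg err_step n (\<lambda>e. (norm e)\<^sup>2) e'"
proof (induction n arbitrary: e e')
  case 0
  show ?case by (simp add: sq_norm_add_le)
next
  case (Suc n)
  have "(\<Sum>i\<in>UNIV. path_avg err_step n (\<lambda>e. (norm e)\<^sup>2) (err_step i (e + e')))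
      \<le> (\<Sum>i\<in>UNIV. 2 * path_avg err_step n (\<lambda>e. (norm e)\<^sup>2) (err_step i e)
          + 2 * path_avg err_step n (\<lambda>e. (norm e)\<^sup>2) (err_step i e'))"
    unfolding err_step_add by (intro sum_mono Suc.IH)
  then show ?case
    by (simp add: sum.distrib sum_distrib_left[symmetric] divide_right_mono flip: add_divide_distrib)
qed

text \<open>Each block is approximated from the range: the remainder never grows in mean square, and
  the approximation is covered by the source case.\<close>

lemma path_avg_err_step_tendsto_0:
  assumes e: "\<And>i. e $ i \<in> closure (range (adjoint K))"
  shows "(\<lambda>n. path_avg err_step n (\<lambda>e. (norm e)\<^sup>2) e) \<longlonglongrightarrow> 0"
proof (rule LIMSEQ_I)
  fix \<epsilon> :: real assume \<epsilon>: "\<epsilon> > 0"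
  let ?a = "\<lambda>n e. path_avg err_step n (\<lambda>e. (norm e)\<^sup>2) e"
  \<comment> \<open>Errors below \<open>\<eta>\<close> in all \<open>CARD('b)\<close> blocks leave a
    remainder of squared norm at most \<open>\<epsilon> / 4\<close>; the factors 2 of the additive
    bound then still give less than \<open>\<epsilon>\<close>.\<close>
  define \<eta> where "\<eta> = sqrt (\<epsilon> / 4) / CARD('b)"
  have "\<eta> > 0" using \<epsilon> by (simp add: \<eta>_def)
  then have "\<exists>w. dist (adjoint K w) (e $ i) < \<eta>" for i
    using e[of i] unfolding closure_approachable by blast
  then obtain w where w: "\<And>i. dist (adjoint K (w i)) (e $ i) < \<eta>" by metis
  define e' where "e' = (\<chi> i. adjoint K (w i))"
  have "norm (e - e') \<le> (\<Sum>i\<in>UNIV. norm ((e - e') $ i))"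
    unfolding norm_vec_def by (rule L2_set_le_sum) simp
  also have "\<dots> \<le> (\<Sum>i\<in>(UNIV::'b set). \<eta>)"
    using w by (intro sum_mono) (auto simp: e'_def dist_norm norm_minus_commute intro: less_imp_le)
  also have "\<dots> = sqrt (\<epsilon> / 4)" by (simp add: \<eta>_def)
  finally have "(norm (e - e'))\<^sup>2 \<le> (sqrt (\<epsilon> / 4))\<^sup>2" by (rule power_mono) simp
  then have "(norm (e - e'))\<^sup>2 \<le> \<epsilon> / 4" using \<epsilon> by simp
  then have small: "?a n (e - e') \<le> \<epsilon> / 4" for n
    using decseqD[OF path_avg_err_step_decseq, of 0 n "e - e'"] by simp
  have "e' = (\<chi> i. adjoint K ((\<chi> i. w i) $ i))" by (simp add: e'_def)
  then have "e' \<in> source_ball (norm (sys_op V (\<lambda>z. z) (\<chi> i. w i)))"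
    unfolding source_ball_def by blast
  then have "(\<lambda>n. ?a n e') \<longlonglongrightarrow> 0" by (rule path_avg_err_step_tendsto_0_source)
  then have "\<forall>\<^sub>F n in sequentially. ?a n e' < \<epsilon> / 4"
    using \<epsilon> by (intro order_tendstoD) auto
  then obtain N where N: "\<forall>n\<ge>N. ?a n e' < \<epsilon> / 4"
    by (auto simp: eventually_sequentially)
  have "norm (?a n e - 0) < \<epsilon>" if "n \<ge> N" for n
  proof -
    have "?a n e \<le> 2 * ?a n (e - e') + 2 * ?a n e'"
      using path_avg_err_step_add_le[of n "e - e'" e'] by simp
    moreover have "?a n e' < \<epsilon> / 4" using N that by blast
    moreover have "0 \<le> ?a n e" by (rule path_avg_nonneg) simp
    ultimately show ?thesis using small[of n] by simp
  qed
  then show "\<exists>N. \<forall>n\<ge>N. norm (?a n e - 0) < \<epsilon>" by blast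
qed

section \<open>The minimum-norm solution\<close>

lemma ker_orthogonal_closure_range_adjoint:
  assumes "K z = 0" and "v \<in> closure (range (adjoint K))"
  shows "inner z v = 0"
proof -
  have "range (adjoint K) \<subseteq> {v. inner z v = 0}"
    by (auto simp: inner_adjoint_right[OF K] assms(1))
  moreover have "closed {v. inner z v = 0}" by (rule closed_hyperplane)
  ultimately show ?thesis using assms(2) closure_minimal by blast
qed

text \<open>Subtracting from \<open>x0\<close> the blockwise projection of \<open>x0 - xs\<close>
  onto the closure of the range yields a solution, since what the projection leaves over lies in the
  kernel of \<open>K\<close>. Pythagoras makes it the unique minimizer.\<close>

lemma min_norm_sol_properties:
  assumes "y \<in> range A"
  shows "A (min_norm_sol A y x0) = y"
    and "(x0 - min_norm_sol A y x0) $ i \<in> closure (range (adjoint K))"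
proof -
  let ?W = "closure (range (adjoint K))"
  obtain xs where xs: "A xs = y" using assms by auto
  have "subspace (range (adjoint K))"
    by (intro linear_subspace_image subspace_UNIV Kt.linear)
  then have "subspace ?W" by (rule subspace_closure)
  then have "\<exists>p\<in>?W. \<forall>s\<in>?W. inner (x0 $ i - xs $ i - p) s = 0" for i
    by (rule closed_subspace_orthogonal_projection[OF _ closed_closure]) blast
  then obtain p where pW: "\<And>i. p i \<in> ?W"
    and orth: "\<And>i s. s \<in> ?W \<Longrightarrow> inner (x0 $ i - xs $ i - p i) s = 0"
    by metis
  define xd where "xd = x0 - (\<chi> i. p i)"
  have "K (xd $ i) = K (xs $ i)" for i
  proof -
    interpret K: bounded_linear K by (rule K)
    have "inner (K (x0 $ i - xs $ i - p i)) v = 0" for v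
      unfolding inner_adjoint_right[OF K, symmetric]
      by (rule orth) (rule subsetD[OF closure_subset], simp)
    then have "K (x0 $ i - xs $ i - p i) = 0" by (metis inner_eq_zero_iff)
    then have "K (x0 $ i) - K (xs $ i) - K (p i) = 0" by (simp only: K.diff)
    moreover have "K (xd $ i) = K (x0 $ i) - K (p i)" by (simp add: xd_def K.diff)
    ultimately show ?thesis by (simp add: algebra_simps)
  qed
  then have Axd: "A xd = y" by (simp add: xs[symmetric] sys_op_def)
  \<comment> \<open>By the left inverse, two solutions differ blockwise by elements of the kernel of
    \<open>K\<close>, which are orthogonal to the blocks \<open>- p i\<close> of
    \<open>xd - x0\<close>.\<close>
  have pyth: "(norm (z - x0))\<^sup>2 = (norm (z - xd))\<^sup>2 + (norm (xd - x0))\<^sup>2" if "A z = y" for z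
  proof -
    have "A (z - xd) = 0" by (simp add: A.diff that Axd)
    then have "(\<chi> i. K ((z - xd) $ i)) = sys_op L (\<lambda>z. z) 0" using L_A by metis
    then have "K ((z - xd) $ i) = 0" for i
      by (simp add: sys_op_def vec_eq_iff)
    then have "inner (z - xd) (xd - x0) = 0"
      unfolding inner_vec_def
      by (intro sum.neutral ballI)
        (auto simp: xd_def intro: ker_orthogonal_closure_range_adjoint[OF _ pW])
    moreover have "z - x0 = (z - xd) + (xd - x0)" by simp
    ultimately show ?thesis
      by (metis (no_types) orthogonal_def norm_add_Pythagorean)
  qed
  have "is_min_norm_sol A y x0 xd"
    unfolding is_min_norm_sol_def
  proof (intro conjI allI impI Axd)
    fix z assume "A z = y"
    then have "(norm (xd - x0))\<^sup>2 \<le> (norm (z - x0))\<^sup>2" using pyth[of z] by simp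
    then show "norm (xd - x0) \<le> norm (z - x0)" by simp
  qed
  \<comment> \<open>Uniqueness lets the definite description in \<open>min_norm_sol\<close> evaluate
    to \<open>xd\<close>.\<close>
  moreover have "z = xd" if "is_min_norm_sol A y x0 z" for z
  proof -
    have z: "A z = y" "norm (z - x0) \<le> norm (xd - x0)"
      using that Axd by (auto simp: is_min_norm_sol_def)
    then have "(norm (z - x0))\<^sup>2 \<le> (norm (xd - x0))\<^sup>2" by (intro power_mono) auto
    then have "(norm (z - xd))\<^sup>2 \<le> 0" using pyth[OF z(1)] by linarith
    then show ?thesis by simp
  qed
  ultimately have "min_norm_sol A y x0 = xd"
    unfolding min_norm_sol_def by (rule the_equality)
  then show "A (min_norm_sol A y x0) = y" and "(x0 - min_norm_sol A y x0) $ i \<in> ?W"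
    using Axd pW by (simp_all add: xd_def)
qed

text \<open>First \<open>N\<close> is fixed from exact data, then \<open>\<delta>\<close> is taken
  small for this \<open>N\<close>; monotonicity finally passes from \<open>N\<close> to
  \<open>k \<delta>\<close>.\<close>

lemma path_avg_sq_dist_tendsto_0:
  assumes y: "y \<in> range A" and yd: "\<And>\<delta>. \<delta> > 0 \<Longrightarrow> norm (yd \<delta> - y) \<le> \<delta>"
    and k: "filterlim k at_top (at_right 0)"
  shows "((\<lambda>\<delta>. path_avg (step \<delta> (yd \<delta>)) (k \<delta>) (\<lambda>x. (norm (x - min_norm_sol A y x0))\<^sup>2) x0) \<longlongrightarrow> 0)
    (at_right 0)"
proof (rule order_tendstoI)
  define z where "z = min_norm_sol A y x0"
  let ?f = "\<lambda>x. (norm (x - z))\<^sup>2"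
  have Az: "A z = y" unfolding z_def by (rule min_norm_sol_properties[OF y])
  have pos: "\<forall>\<^sub>F \<delta> in at_right 0. 0 < (\<delta>::real)" by (rule eventually_at_right_less)
  fix a :: real
  show "\<forall>\<^sub>F \<delta> in at_right 0. a < path_avg (step \<delta> (yd \<delta>)) (k \<delta>) (\<lambda>x. (norm (x - min_norm_sol A y x0))\<^sup>2) x0"
    if "a < 0"
    by (intro always_eventually allI less_le_trans[OF that] path_avg_nonneg) simp
  assume a: "0 < a"
  have "(\<lambda>n. path_avg err_step n (\<lambda>e. (norm e)\<^sup>2) (x0 - z)) \<longlonglongrightarrow> 0"
    unfolding z_def by (intro path_avg_err_step_tendsto_0 min_norm_sol_properties[OF y])
  then have "\<forall>\<^sub>F n in sequentially. path_avg err_step n (\<lambda>e. (norm e)\<^sup>2) (x0 - z) < a"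
    using a by (rule order_tendstoD)
  then obtain N where "path_avg err_step N (\<lambda>e. (norm e)\<^sup>2) (x0 - z) < a"
    by (auto simp: eventually_sequentially)
  then have exact: "path_avg (step 0 y) N ?f x0 < a"
    using path_avg_semiconj[of "\<lambda>x. x - z" "step 0 y" err_step N "\<lambda>e. (norm e)\<^sup>2" x0] step_0_diff[of z]
    by (simp add: Az)
  have "((\<lambda>\<delta>. yd \<delta> - y) \<longlongrightarrow> 0) (at_right 0)"
    by (rule Lim_null_comparison[OF eventually_mono[OF pos yd]]) (auto intro: tendsto_ident_at)
  then have "(yd \<longlongrightarrow> y) (at_right 0)" by (rule LIM_zero_cancel)
  then have "((\<lambda>\<delta>. path_avg (step \<delta> (yd \<delta>)) N ?f x0) \<longlongrightarrow> path_avg (step 0 y) N ?f x0) (at_right 0)"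
    by (intro tendsto_path_avg tendsto_step) (auto intro!: tendsto_intros)
  then have "\<forall>\<^sub>F \<delta> in at_right 0. path_avg (step \<delta> (yd \<delta>)) N ?f x0 < a"
    using exact by (rule order_tendstoD)
  moreover have "\<forall>\<^sub>F \<delta> in at_right 0. N \<le> k \<delta>"
    using k by (simp add: filterlim_at_top)
  ultimately show "\<forall>\<^sub>F \<delta> in at_right 0.
      path_avg (step \<delta> (yd \<delta>)) (k \<delta>) (\<lambda>x. (norm (x - min_norm_sol A y x0))\<^sup>2) x0 < a"
    using pos
  proof eventually_elim
    case (elim \<delta>)
    have "path_avg (step \<delta> (yd \<delta>)) (k \<delta>) ?f x0 \<le> path_avg (step \<delta> (yd \<delta>)) N ?f x0"
      using elim yd Az by (intro path_avg_sq_dist_antimono) auto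
    then show ?case using elim by (simp add: z_def)
  qed
qed

end

section \<open>Passage from the hypotheses of the theorem to the locale\<close>

lemma step_bound_D:
  assumes "ereal \<gamma> < step_bound V K \<tau>" and "0 < \<gamma>" and "1 < \<tau>"
  shows "\<gamma> * (max_col_sq V * (onorm K)\<^sup>2) \<le> 2"
    and "\<gamma> * (onorm (sys_op V K))\<^sup>2 < 2 - 2 / \<tau>"
proof -
  \<comment> \<open>For \<open>c = 0\<close> the quotient is infinite and the claim reads
    \<open>0 < r\<close>; otherwise the inequality is multiplied by \<open>c\<close>.\<close>
  have lt: "\<gamma> * c < r" if "ereal \<gamma> < ereal r / ereal c" "0 \<le> c" "0 < r" for c r
    using that by (cases "c = 0") (auto simp: field_simps)
  \<comment> \<open>Any column serves here, as the maximum dominates each squared column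
    norm.\<close>
  have "0 \<le> (norm (column undefined V))\<^sup>2" by simp
  also have "\<dots> \<le> max_col_sq V" unfolding max_col_sq_def by (rule Max_ge) auto
  finally have "0 \<le> max_col_sq V * (onorm K)\<^sup>2" by simp
  moreover have "ereal \<gamma> < ereal 2 / ereal (max_col_sq V * (onorm K)\<^sup>2)"
    using assms(1) by (simp add: step_bound_def)
  ultimately show "\<gamma> * (max_col_sq V * (onorm K)\<^sup>2) \<le> 2" using lt by fastforce
  have "ereal \<gamma> < ereal (2 - 2 / \<tau>) / ereal ((onorm (sys_op V K))\<^sup>2)"
    using assms(1) by (simp add: step_bound_def)
  then show "\<gamma> * (onorm (sys_op V K))\<^sup>2 < 2 - 2 / \<tau>"
    using assms(3) by (intro lt) (auto simp: field_simps)
qed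

theorem theorem2p12:
  fixes K :: "'x::{real_inner, complete_space} \<Rightarrow> 'y::{real_inner, complete_space}"
    and V :: "real ^ 'b ^ 'd"
    and y :: "'y ^ 'd" and yd :: "real \<Rightarrow> 'y ^ 'd"
    and x0 :: "'x ^ 'b"
    and \<gamma> \<tau> :: real
    and M :: "'w measure" and I :: "nat \<Rightarrow> 'w \<Rightarrow> 'b"
    and k :: "real \<Rightarrow> nat"
  assumes "bounded_linear K"
    and "y \<in> range (sys_op V K)"
    and "\<And>\<delta>. \<delta> > 0 \<Longrightarrow> norm (yd \<delta> - y) \<le> \<delta>"
    and "\<tau> > 1"
    and "rank V = CARD('b)"
    and "0 < \<gamma>" and "ereal \<gamma> < step_bound V K \<tau>"
    and "prob_space M"
    and "prob_space.indep_vars M (\<lambda>_. count_space UNIV) I UNIV"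
    and "\<And>n. distr M (count_space UNIV) (I n) = uniform_count_measure UNIV"
    and "filterlim k at_top (at_right 0)"
  shows "((\<lambda>\<delta>. prob_space.expectation M
            (\<lambda>\<omega>. (norm (rbcd V K \<gamma> \<tau> \<delta> (yd \<delta>) x0 (\<lambda>n. I n \<omega>) (k \<delta>)
                       - min_norm_sol (sys_op V K) y x0))\<^sup>2)) \<longlongrightarrow> 0) (at_right 0)"
proof -
  \<comment> \<open>Full column rank means injectivity, hence a left inverse.\<close>
  obtain L where "L ** V = mat 1"
    using assms(5) by (auto simp: full_rank_injective simp flip: matrix_left_invertible_injective)
  then interpret rbcd_system K V L \<gamma> \<tau>
    using assms(1,4,6) step_bound_D[OF assms(7,6,4)] by (intro rbcd_system.intro)
  \<comment> \<open>As \<open>k \<delta>\<close> is deterministic, the expectation at each fixed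
    \<open>\<delta>\<close> is exactly a path average.\<close>
  show ?thesis
    unfolding rbcd_eq_trajectory
      expectation_trajectory[OF assms(8-10), where f = "\<lambda>x. (norm (x - min_norm_sol A y x0))\<^sup>2"]
    by (rule path_avg_sq_dist_tendsto_0[OF assms(2,3,11)])
qed

end
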